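(* Let $A$ be a nonnegative square matrix. The following are equivalent: 1. $A$ and $A^{\top}A$ are irreducible; 2. $A^2$ and $A^{\top}A$ are irreducible; 3. $A$ and $AA^{\top}$ are irreducible; 4. $A^2$ and $AA^{\top}$ are irreducible; 5. $A$, $A^2$, $A^{\top}A$, and $AA^{\top}$ are irreducible; 6. the directed graph of $A$ is strongly connected and the simple bipartite graph of $A$ is connected.
   Context: A nonnegative $n\times n$ matrix $A$ is irreducible if for every pair of indices $(i,j)$ there is an integer $m\ge1$ with $[A^m]_{ij}>0$ (so the $1\times 1$ zero matrix is not irreducible). The directed graph of an $n\times n$ matrix $A$ has $n$ vertices $1,\dots,n$ and an edge from vertex $j$ to vertex $i$ exactly when $A_{ij}\ne0$. The simple bipartite graph of an $n\times m$ matrix $A$ has $n$ row vertices $X_1,\dots,X_n$, $m$ column vertices $Y_1,\dots,Y_m$, and an undirected edge between $X_i$ and $Y_j$ exactly when $A_{ij}\ne0$. *)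

theory Defs
  imports "Jordan_Normal_Form.Matrix" "Graph_Theory.Graph_Theory"
begin

text \<open>Indices of an \<open>n \<times> n\<close> matrix are \<open>0, \<dots>, n - 1\<close>.\<close>

definition nonnegative_mat :: "real mat \<Rightarrow> bool" where
  "nonnegative_mat A \<longleftrightarrow> (\<forall>i < dim_row A. \<forall>j < dim_col A. A $$ (i, j) \<ge> 0)"

text \<open>
  The exponent \<open>m = 0\<close> is excluded, so the \<open>1 \<times> 1\<close> zero matrix is not irreducible.
\<close>

definition irreducible_mat :: "real mat \<Rightarrow> bool" where
  "irreducible_mat A \<longleftrightarrow> square_mat A \<and> nonnegative_mat A \<and>
     (\<forall>i < dim_row A. \<forall>j < dim_row A. \<exists>m::nat. m \<ge> 1 \<and> (A ^\<^sub>m m) $$ (i, j) > 0)"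

text \<open>Arcs are pairs (tail, head): the entry \<open>A $$ (i, j)\<close> gives an arc from \<open>j\<close> to \<open>i\<close>.\<close>

definition digraph_of_mat :: "real mat \<Rightarrow> nat pair_pre_digraph" where
  "digraph_of_mat A = \<lparr> pverts = {0..<dim_row A},
     parcs = {(j, i) | i j. i < dim_row A \<and> j < dim_col A \<and> A $$ (i, j) \<noteq> 0} \<rparr>"

text \<open>
  Row vertices are \<open>Inl i\<close> and column vertices are \<open>Inr j\<close>. As usual in the graph library,
  an undirected edge is represented by a pair of opposite arcs.
\<close>

definition bipartite_graph_of_mat :: "real mat \<Rightarrow> (nat + nat) pair_pre_digraph" where
  "bipartite_graph_of_mat A = \<lparr> pverts = Inl ` {0..<dim_row A} \<union> Inr ` {0..<dim_col A},
     parcs = {(Inl i, Inr j) | i j. i < dim_row A \<and> j < dim_col A \<and> A $$ (i, j) \<noteq> 0} \<union>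
             {(Inr j, Inl i) | i j. i < dim_row A \<and> j < dim_col A \<and> A $$ (i, j) \<noteq> 0} \<rparr>"

end

theory Submission
  imports Defs
begin

text \<open>
  Irreducibility of a nonnegative matrix depends only on its support relation \<open>R\<close>, and supports of
  products are relational compositions, so everything reduces to a statement about \<open>R\<close>.
  The heart is that if \<open>R\<close> and \<open>R\<inverse> O R\<close> are both connected, then so is \<open>R O R\<close>: the vertices
  reachable from a fixed vertex by nonempty even walks form a set closed under \<open>R\<inverse> O R\<close>.
  The relations \<open>R\<inverse> O R\<close> and \<open>R O R\<inverse>\<close> describe two-step walks between column vertices and between
  row vertices of the bipartite graph; when no row or column of the matrix vanishes, each of them
  is connected exactly when that graph is.
\<close>

section \<open>Relations\<close>

lemma trancl_relcomp_self_subset: "(R O R)\<^sup>+ \<subseteq> R\<^sup>+"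
proof (rule subrelI)
  fix i j assume "(i, j) \<in> (R O R)\<^sup>+"
  then show "(i, j) \<in> R\<^sup>+"
    by (induction rule: trancl_induct) (blast intro: trancl_into_trancl trancl_trans)+
qed

lemma relpow_even: "R ^^ (2 * m) = (R O R) ^^ m"
proof (induction m)
  case (Suc m)
  have "R ^^ (2 * Suc m) = R ^^ (2 * m) O R O R" by (simp add: O_assoc)
  then show ?case using Suc by simp
qed simp

lemma relpow_square: "R ^^ 2 = R O R"
  using relpow_even[of 1 R] by simp

lemma relpow_even_trancl:
  assumes "(i, j) \<in> R ^^ m" "even m" "m > 0"
  shows "(i, j) \<in> (R O R)\<^sup>+"
proof -
  from assms(2,3) obtain k where k: "m = 2 * k" "k > 0" by (auto elim!: evenE)
  with assms(1) have "(i, j) \<in> (R O R) ^^ k" by (metis relpow_even)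
  with k show ?thesis using trancl_power by blast
qed

text \<open>Let \<open>j\<close> and \<open>k\<close> have the common predecessor \<open>l\<close>.
  If some walk from \<open>j\<close> to \<open>l\<close> is odd, the arc to \<open>k\<close> makes
  it even. Otherwise the arc from \<open>l\<close> back to \<open>j\<close> closes an odd walk at
  \<open>j\<close>, which repairs the parity of any walk from \<open>j\<close> to
  \<open>k\<close>.\<close>

lemma total_trancl_two_step:
  assumes R: "R \<subseteq> V \<times> V" and conn: "V \<times> V \<subseteq> R\<^sup>+" and conn2: "V \<times> V \<subseteq> (R\<inverse> O R)\<^sup>+"
  shows "V \<times> V \<subseteq> (R O R)\<^sup>+"
proof safe
  fix i j assume i: "i \<in> V" and j: "j \<in> V"
  from i conn have "(i, i) \<in> R\<^sup>+" by auto
  then obtain m where m: "m > 0" "(i, i) \<in> R ^^ m" using trancl_power by blast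
  \<comment> \<open>Running a closed walk twice makes its length even; this starts the induction at
    \<open>i\<close> with a nonempty walk.\<close>
  then have "(i, i) \<in> R ^^ (m + m)" by (auto simp: relpow_add)
  then have ii: "(i, i) \<in> (R O R)\<^sup>+" by (rule relpow_even_trancl) (use m(1) in auto)
  have even_step: "(i, k) \<in> (R O R)\<^sup>+" if ij: "(i, j) \<in> (R O R)\<^sup>+" and jk: "(j, k) \<in> R\<inverse> O R" for j k
  proof -
    from ij obtain p where p: "p > 0" "(i, j) \<in> (R O R) ^^ p" using trancl_power by blast
    then have ij': "(i, j) \<in> R ^^ (2 * p)" by (simp only: relpow_even)
    from jk obtain l where l: "(l, j) \<in> R" "(l, k) \<in> R" by auto
    with R have V: "j \<in> V" "l \<in> V" "k \<in> V" by auto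
    with conn obtain q where q: "q > 0" "(j, l) \<in> R ^^ q" using trancl_power by blast
    show ?thesis
    proof (cases "odd q")
      case True
      have "(j, k) \<in> R ^^ Suc q" using q(2) l(2) by auto
      with ij' have "(i, k) \<in> R ^^ (2 * p + Suc q)" by (auto simp only: relpow_add)
      then show ?thesis by (rule relpow_even_trancl) (use True in auto)
    next
      case False
      \<comment> \<open>\<open>R\<close> now has a closed walk of odd length at \<open>j\<close>, which corrects the parity of any walk.\<close>
      have jj: "(j, j) \<in> R ^^ Suc q" using q(2) l(1) by auto
      from V conn obtain r where r: "r > 0" "(j, k) \<in> R ^^ r" using trancl_power by blast
      show ?thesis
      proof (cases "even r")
        case True
        from ij' r have "(i, k) \<in> R ^^ (2 * p + r)" by (auto simp only: relpow_add)
        then show ?thesis by (rule relpow_even_trancl) (use True r(1) in auto)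
      next
        case odd: False
        from jj r have "(j, k) \<in> R ^^ (Suc q + r)" by (auto simp only: relpow_add)
        with ij' have "(i, k) \<in> R ^^ (2 * p + (Suc q + r))" by (auto simp only: relpow_add)
        then show ?thesis by (rule relpow_even_trancl) (use odd False in auto)
      qed
    qed
  qed
  from i j conn2 have "(i, j) \<in> (R\<inverse> O R)\<^sup>+" by auto
  then show "(i, j) \<in> (R O R)\<^sup>+"
  proof (induction rule: trancl_induct)
    case (base k)
    with ii show ?case by (rule even_step)
  next
    case (step k l)
    from this(3,2) show ?case by (rule even_step)
  qed
qed

text \<open>The walk is a zigzag from \<open>i\<close> to \<open>j\<close> whose double steps pass
  through common predecessors. With \<open>k\<close> and \<open>l\<close> attached at its ends, the
  same zigzag can be regrouped into double steps between these predecessors.\<close>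

lemma trancl_converse_comp_conjugate:
  assumes "(i, j) \<in> (R\<inverse> O R)\<^sup>+" "(k, i) \<in> R" "(l, j) \<in> R"
  shows "(k, l) \<in> (R O R\<inverse>)\<^sup>+"
  using assms(1,3)
proof (induction arbitrary: l rule: trancl_induct)
  case (base j)
  then obtain p where "(p, i) \<in> R" "(p, j) \<in> R" by auto
  with base assms(2) have "(k, p) \<in> R O R\<inverse>" "(p, l) \<in> R O R\<inverse>" by auto
  then show ?case by auto
next
  case (step j j')
  then obtain p where "(p, j) \<in> R" "(p, j') \<in> R" by auto
  with step have "(k, p) \<in> (R O R\<inverse>)\<^sup>+" "(p, l) \<in> R O R\<inverse>" by auto
  then show ?case by auto
qed

lemma total_trancl_imp_Domain_Range:
  assumes "V \<times> V \<subseteq> R\<^sup>+"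
  shows "V \<subseteq> Domain R" "V \<subseteq> Range R"
proof -
  have "(i, i) \<in> R\<^sup>+" if "i \<in> V" for i using assms that by auto
  then show "V \<subseteq> Domain R" "V \<subseteq> Range R"
    by (metis DomainI subsetI trancl_domain, metis RangeI subsetI trancl_range)
qed

lemma total_trancl_comp_converse_imp:
  assumes R: "R \<subseteq> V \<times> V" "V \<subseteq> Domain R" and conn: "V \<times> V \<subseteq> (R\<inverse> O R)\<^sup>+"
  shows "V \<times> V \<subseteq> (R O R\<inverse>)\<^sup>+"
proof safe
  fix k l assume "k \<in> V" "l \<in> V"
  with R obtain i j where "(k, i) \<in> R" "(l, j) \<in> R" by blast
  moreover from this R have "i \<in> V" "j \<in> V" by auto
  ultimately show "(k, l) \<in> (R O R\<inverse>)\<^sup>+"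
    using conn by (blast intro: trancl_converse_comp_conjugate)
qed

text \<open>Connectedness of \<open>R\<close> gives every vertex a successor and a predecessor, so
  the preceding implication applies to both \<open>R\<close> and \<open>R\<inverse>\<close>.\<close>

lemma total_trancl_comp_converse_iff:
  assumes R: "R \<subseteq> V \<times> V" and conn: "V \<times> V \<subseteq> R\<^sup>+"
  shows "V \<times> V \<subseteq> (R\<inverse> O R)\<^sup>+ \<longleftrightarrow> V \<times> V \<subseteq> (R O R\<inverse>)\<^sup>+"
proof -
  have R': "R\<inverse> \<subseteq> V \<times> V" "V \<subseteq> Domain (R\<inverse>)" "V \<subseteq> Domain R"
    using R total_trancl_imp_Domain_Range[OF conn] by auto
  show ?thesis
    using total_trancl_comp_converse_imp[OF R R'(3)] total_trancl_comp_converse_imp[OF R'(1,2)]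
    by auto
qed

section \<open>Walks in the bipartite graph of a relation\<close>

definition bipartite_rel :: "('a \<times> 'b) set \<Rightarrow> (('a + 'b) \<times> ('a + 'b)) set" where
  "bipartite_rel R = {(Inl i, Inr j) | i j. (i, j) \<in> R} \<union> {(Inr j, Inl i) | i j. (i, j) \<in> R}"

lemma sym_bipartite_rel: "sym (bipartite_rel R)"
  by (auto simp: bipartite_rel_def sym_def)

lemma bipartite_rel_cases:
  assumes "(x, y) \<in> bipartite_rel R"
  obtains (row_column) i j where "x = Inl i" "y = Inr j" "(i, j) \<in> R"
    | (column_row) i j where "x = Inr j" "y = Inl i" "(i, j) \<in> R"
  using assms by (auto simp: bipartite_rel_def)

text \<open>Walks alternate between the two sides, so the induction needs an invariant at row
  vertices too: there the last double step is half done.\<close>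

lemma bipartite_rel_rtrancl_from_column:
  assumes "(Inr i, x) \<in> (bipartite_rel R)\<^sup>*"
  shows "case x of Inr j \<Rightarrow> (i, j) \<in> (R\<inverse> O R)\<^sup>* | Inl k \<Rightarrow> \<exists>j. (i, j) \<in> (R\<inverse> O R)\<^sup>* \<and> (k, j) \<in> R"
  using assms
proof (induction rule: rtrancl_induct)
  case (step x y)
  from step(2) show ?case
  proof (cases rule: bipartite_rel_cases)
    case (row_column k j)
    with step obtain l where "(i, l) \<in> (R\<inverse> O R)\<^sup>*" "(k, l) \<in> R" by auto
    moreover from this row_column have "(l, j) \<in> R\<inverse> O R" by auto
    ultimately show ?thesis using row_column by (auto intro: rtrancl_into_rtrancl)
  next
    case (column_row k j)
    with step show ?thesis by auto
  qed
qed simp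

lemma bipartite_rel_rtrancl_columns:
  assumes "(i, j) \<in> (R\<inverse> O R)\<^sup>*"
  shows "(Inr i, Inr j) \<in> (bipartite_rel R)\<^sup>*"
  using assms
proof (induction rule: rtrancl_induct)
  case (step j k)
  then obtain l where "(l, j) \<in> R" "(l, k) \<in> R" by auto
  then have "(Inr j, Inl l) \<in> bipartite_rel R" "(Inl l, Inr k) \<in> bipartite_rel R"
    by (auto simp: bipartite_rel_def)
  with step show ?case by (meson rtrancl.rtrancl_into_rtrancl)
qed simp

text \<open>The left side allows empty walks and the right side does not; the absence of zero rows
  and columns bridges this gap.\<close>

lemma bipartite_rel_total_iff:
  assumes sub: "R \<subseteq> V \<times> V"
  shows "(V <+> V) \<times> (V <+> V) \<subseteq> (bipartite_rel R)\<^sup>* \<longleftrightarrow>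
    V \<subseteq> Domain R \<and> V \<times> V \<subseteq> (R\<inverse> O R)\<^sup>+" (is "?L \<longleftrightarrow> ?R")
proof
  assume L: ?L
  have cross: "(\<exists>k. (i, k) \<in> R) \<and> (\<exists>k. (k, i) \<in> R)" if "i \<in> V" for i
  proof -
    \<comment> \<open>These vertices are distinct, so the walk is nonempty: its first and last edges
      show that row \<open>i\<close> and column \<open>i\<close> do not vanish.\<close>
    from L that have "(Inl i, Inr i) \<in> (bipartite_rel R)\<^sup>*" by auto
    then have "(Inl i, Inr i) \<in> (bipartite_rel R)\<^sup>+" by (auto simp: rtrancl_eq_or_trancl)
    then have "Inl i \<in> Domain (bipartite_rel R)" "Inr i \<in> Range (bipartite_rel R)"
      by (metis DomainI trancl_domain, metis RangeI \<open>(Inl i, Inr i) \<in> (bipartite_rel R)\<^sup>+\<close> trancl_range)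
    then show ?thesis by (auto simp: bipartite_rel_def)
  qed
  have "(i, j) \<in> (R\<inverse> O R)\<^sup>+" if "i \<in> V" "j \<in> V" for i j
  proof (cases "i = j")
    case True
    \<comment> \<open>A predecessor of \<open>i\<close> gives a double step from \<open>i\<close> to
      itself, replacing the empty walk.\<close>
    with cross[OF that(1)] show ?thesis by blast
  next
    case False
    from L that have "(Inr i, Inr j) \<in> (bipartite_rel R)\<^sup>*" by auto
    from bipartite_rel_rtrancl_from_column[OF this] False show ?thesis
      by (auto simp: rtrancl_eq_or_trancl)
  qed
  moreover from cross have "V \<subseteq> Domain R" by blast
  ultimately show ?R by (simp add: subset_iff)
next
  assume R: ?R
  \<comment> \<open>Each row vertex has a column neighbour, so it suffices to connect column
    vertices.\<close>
  have column: "\<exists>j\<in>V. (x, Inr j) \<in> (bipartite_rel R)\<^sup>*" if "x \<in> V <+> V" for x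
  proof (cases x)
    case (Inl i)
    with that R obtain j where "(i, j) \<in> R" by blast
    with Inl sub show ?thesis by (auto simp: bipartite_rel_def intro!: bexI[of _ j])
  qed (use that in auto)
  show ?L
  proof (rule subrelI)
    fix x y assume "(x, y) \<in> (V <+> V) \<times> (V <+> V)"
    then obtain i j where i: "i \<in> V" "(x, Inr i) \<in> (bipartite_rel R)\<^sup>*"
      and j: "j \<in> V" "(y, Inr j) \<in> (bipartite_rel R)\<^sup>*"
      using column by (metis mem_Sigma_iff)
    from R i(1) j(1) have "(Inr i, Inr j) \<in> (bipartite_rel R)\<^sup>*"
      by (intro bipartite_rel_rtrancl_columns trancl_into_rtrancl) auto
    moreover from j(2) have "(Inr j, y) \<in> (bipartite_rel R)\<^sup>*"
      by (rule symD[OF sym_rtrancl[OF sym_bipartite_rel]])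
    ultimately show "(x, y) \<in> (bipartite_rel R)\<^sup>*" using i(2) by (meson rtrancl_trans)
  qed
qed

section \<open>Supports of nonnegative matrices\<close>

text \<open>Pairs are (row, column), so that matrix products become \<open>O\<close> in the same
  order; the arcs of \<open>digraph_of_mat\<close> are the converse.\<close>

definition supp_mat :: "'a::zero mat \<Rightarrow> (nat \<times> nat) set" where
  "supp_mat A = {(i, j). i < dim_row A \<and> j < dim_col A \<and> A $$ (i, j) \<noteq> 0}"

lemma supp_mat_subset: "A \<in> carrier_mat n m \<Longrightarrow> supp_mat A \<subseteq> {0..<n} \<times> {0..<m}"
  by (auto simp: supp_mat_def)

lemma supp_mat_transpose: "supp_mat (transpose_mat A) = (supp_mat A)\<inverse>"
  by (auto simp: supp_mat_def)

lemma nonnegative_mat_transpose: "nonnegative_mat A \<Longrightarrow> nonnegative_mat (transpose_mat A)"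
  by (auto simp: nonnegative_mat_def)

lemma nonnegative_mat_mult:
  assumes "A \<in> carrier_mat n k" "B \<in> carrier_mat k m" "nonnegative_mat A" "nonnegative_mat B"
  shows "nonnegative_mat (A * B)"
  using assms by (auto simp: nonnegative_mat_def scalar_prod_def intro!: sum_nonneg)

text \<open>Nonnegativity excludes cancellation: a sum of nonnegative terms vanishes only if every
  term does.\<close>

lemma supp_mat_mult:
  assumes A: "A \<in> carrier_mat n k" and B: "B \<in> carrier_mat k m"
    and nn: "nonnegative_mat A" "nonnegative_mat B"
  shows "supp_mat (A * B) = supp_mat A O supp_mat B"
proof -
  have "(A * B) $$ (i, j) \<noteq> 0 \<longleftrightarrow> (\<exists>l<k. A $$ (i, l) \<noteq> 0 \<and> B $$ (l, j) \<noteq> 0)"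
    if "i < n" "j < m" for i j
  proof -
    have "(A * B) $$ (i, j) = (\<Sum>l = 0..<k. A $$ (i, l) * B $$ (l, j))"
      using A B that by (simp add: scalar_prod_def)
    moreover have "0 \<le> A $$ (i, l) * B $$ (l, j)" if "l \<in> {0..<k}" for l
      using A B nn \<open>i < n\<close> \<open>j < m\<close> that by (auto simp: nonnegative_mat_def)
    ultimately have "(A * B) $$ (i, j) = 0 \<longleftrightarrow> (\<forall>l\<in>{0..<k}. A $$ (i, l) * B $$ (l, j) = 0)"
      using sum_nonneg_eq_0_iff[of "{0..<k}" "\<lambda>l. A $$ (i, l) * B $$ (l, j)"] by simp
    then show ?thesis by auto
  qed
  then show ?thesis using A B by (fastforce simp: supp_mat_def)
qed

lemma nonnegative_mat_pow:
  assumes "A \<in> carrier_mat n n" "nonnegative_mat A"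
  shows "nonnegative_mat (A ^\<^sub>m m)"
proof (induction m)
  case 0
  then show ?case by (auto simp: nonnegative_mat_def)
next
  case (Suc m)
  have "A ^\<^sub>m m \<in> carrier_mat n n" using assms(1) by (rule pow_carrier_mat)
  from nonnegative_mat_mult[OF this assms(1) Suc assms(2)] show ?case by simp
qed

text \<open>The exponent 0 is excluded because \<open>R ^^ 0\<close> is the identity on all
  naturals, not only on the indices below \<open>n\<close>.\<close>

lemma supp_mat_pow:
  assumes "A \<in> carrier_mat n n" "nonnegative_mat A" "m > 0"
  shows "supp_mat (A ^\<^sub>m m) = supp_mat A ^^ m"
  using assms(3)
proof (induction m rule: nat_induct_non_zero)
  case 1
  then show ?case using assms(1) by simp
next
  case (Suc m)
  have "A ^\<^sub>m m \<in> carrier_mat n n" using assms(1) by (rule pow_carrier_mat)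
  from supp_mat_mult[OF this assms(1) nonnegative_mat_pow[OF assms(1,2)] assms(2)] Suc
  show ?case by simp
qed

text \<open>The condition \<open>m \<ge> 1\<close> matches the positive powers that make up
  \<open>trancl\<close>.\<close>

lemma irreducible_mat_iff_supp:
  assumes A: "A \<in> carrier_mat n n" and nn: "nonnegative_mat A"
  shows "irreducible_mat A \<longleftrightarrow> {0..<n} \<times> {0..<n} \<subseteq> (supp_mat A)\<^sup>+"
proof -
  have "(A ^\<^sub>m m) $$ (i, j) > 0 \<longleftrightarrow> (i, j) \<in> supp_mat A ^^ m"
    if "i < n" "j < n" "m > 0" for i j m
  proof -
    have "A ^\<^sub>m m \<in> carrier_mat n n" using A by (rule pow_carrier_mat)
    then have "(i, j) \<in> supp_mat (A ^\<^sub>m m) \<longleftrightarrow> (A ^\<^sub>m m) $$ (i, j) \<noteq> 0"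
      "(A ^\<^sub>m m) $$ (i, j) \<ge> 0"
      using that A nonnegative_mat_pow[OF A nn, of m] by (auto simp: supp_mat_def nonnegative_mat_def)
    then show ?thesis using supp_mat_pow[OF A nn that(3)] by auto
  qed
  then have "(\<exists>m\<ge>1. (A ^\<^sub>m m) $$ (i, j) > 0) \<longleftrightarrow> (i, j) \<in> (supp_mat A)\<^sup>+" if "i < n" "j < n" for i j
    using that unfolding trancl_power by (metis One_nat_def Suc_le_eq)
  moreover have "square_mat A" "dim_row A = n" using A by auto
  ultimately show ?thesis using nn by (auto simp: irreducible_mat_def subset_iff)
qed

section \<open>Graphs\<close>

lemma strongly_connected_with_proj_iff:
  assumes "parcs G \<subseteq> pverts G \<times> pverts G"
  shows "strongly_connected (with_proj G) \<longleftrightarrow>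
    pverts G \<noteq> {} \<and> pverts G \<times> pverts G \<subseteq> (parcs G)\<^sup>*"
proof -
  have "u \<rightarrow>\<^sup>*\<^bsub>with_proj G\<^esub> v \<longleftrightarrow> (u, v) \<in> (parcs G)\<^sup>*" if u: "u \<in> pverts G" for u v
  proof
    assume "(u, v) \<in> (parcs G)\<^sup>*"
    then show "u \<rightarrow>\<^sup>*\<^bsub>with_proj G\<^esub> v"
      by (induction rule: rtrancl_induct)
        (use u assms in \<open>auto simp: reachable_def intro: rtrancl_on_into_rtrancl_on\<close>)
  qed (auto dest: reachable_rtranclI)
  then show ?thesis by (auto simp: strongly_connected_def)
qed

text \<open>The library defines connectedness as strong connectedness of the symmetric closure,
  which changes nothing here.\<close>

lemma connected_with_proj_iff:
  assumes "parcs G \<subseteq> pverts G \<times> pverts G" "sym (parcs G)"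
  shows "Digraph_Component.connected (with_proj G) \<longleftrightarrow>
    pverts G \<noteq> {} \<and> pverts G \<times> pverts G \<subseteq> (parcs G)\<^sup>*"
proof -
  have "mk_symmetric (with_proj G) = G"
    using assms(2) by (cases G) (auto simp: mk_symmetric_def sym_def)
  then show ?thesis
    using strongly_connected_with_proj_iff[OF assms(1)] by (simp add: connected_def)
qed

lemma strongly_connected_digraph_of_mat_iff:
  assumes "A \<in> carrier_mat n n" "n \<ge> 1"
  shows "strongly_connected (with_proj (digraph_of_mat A)) \<longleftrightarrow>
    {0..<n} \<times> {0..<n} \<subseteq> (supp_mat A)\<^sup>*"
proof -
  have eq: "parcs (digraph_of_mat A) = (supp_mat A)\<inverse>" "pverts (digraph_of_mat A) = {0..<n}"
    using assms(1) by (auto simp: digraph_of_mat_def supp_mat_def)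
  show ?thesis
    by (subst strongly_connected_with_proj_iff)
      (use supp_mat_subset[OF assms(1)] assms(2) in \<open>auto simp: eq rtrancl_converse subset_iff\<close>)
qed

lemma connected_bipartite_graph_of_mat_iff:
  assumes "A \<in> carrier_mat n n" "n \<ge> 1"
  shows "Digraph_Component.connected (with_proj (bipartite_graph_of_mat A)) \<longleftrightarrow>
    {0..<n} \<subseteq> Domain (supp_mat A) \<and>
    {0..<n} \<times> {0..<n} \<subseteq> ((supp_mat A)\<inverse> O supp_mat A)\<^sup>+"
proof -
  have eq: "parcs (bipartite_graph_of_mat A) = bipartite_rel (supp_mat A)"
    "pverts (bipartite_graph_of_mat A) = {0..<n} <+> {0..<n}"
    using assms(1) by (auto simp: bipartite_graph_of_mat_def supp_mat_def bipartite_rel_def Plus_def)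
  have sub: "bipartite_rel (supp_mat A) \<subseteq> ({0..<n} <+> {0..<n}) \<times> ({0..<n} <+> {0..<n})"
    using supp_mat_subset[OF assms(1)] by (auto simp: bipartite_rel_def)
  have "{0..<n} <+> {0..<n} \<noteq> {}" using assms(2) by auto
  then show ?thesis
    using connected_with_proj_iff[of "bipartite_graph_of_mat A"] sub sym_bipartite_rel
    unfolding eq bipartite_rel_total_iff[OF supp_mat_subset[OF assms(1)]] by blast
qed

theorem theorem13:
  fixes A :: "real mat" and n :: nat
  assumes "n \<ge> 1" and "A \<in> carrier_mat n n" and "nonnegative_mat A"
  shows
    "(irreducible_mat A \<and> irreducible_mat (transpose_mat A * A)
        \<longleftrightarrow> irreducible_mat (A ^\<^sub>m 2) \<and> irreducible_mat (transpose_mat A * A)) \<and>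
     (irreducible_mat (A ^\<^sub>m 2) \<and> irreducible_mat (transpose_mat A * A)
        \<longleftrightarrow> irreducible_mat A \<and> irreducible_mat (A * transpose_mat A)) \<and>
     (irreducible_mat A \<and> irreducible_mat (A * transpose_mat A)
        \<longleftrightarrow> irreducible_mat (A ^\<^sub>m 2) \<and> irreducible_mat (A * transpose_mat A)) \<and>
     (irreducible_mat (A ^\<^sub>m 2) \<and> irreducible_mat (A * transpose_mat A)
        \<longleftrightarrow> irreducible_mat A \<and> irreducible_mat (A ^\<^sub>m 2) \<and>
            irreducible_mat (transpose_mat A * A) \<and> irreducible_mat (A * transpose_mat A)) \<and>
     (irreducible_mat A \<and> irreducible_mat (A ^\<^sub>m 2) \<and>
      irreducible_mat (transpose_mat A * A) \<and> irreducible_mat (A * transpose_mat A)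
        \<longleftrightarrow> strongly_connected (with_proj (digraph_of_mat A)) \<and>
            Digraph_Component.connected (with_proj (bipartite_graph_of_mat A)))"
proof -
  let ?V = "{0..<n}" and ?R = "supp_mat A"
  note A = assms(2) and nn = assms(3)
  have At: "transpose_mat A \<in> carrier_mat n n" "nonnegative_mat (transpose_mat A)"
    using A nn nonnegative_mat_transpose by auto
  have R: "?R \<subseteq> ?V \<times> ?V" by (rule supp_mat_subset[OF A])
  have a: "irreducible_mat A \<longleftrightarrow> ?V \<times> ?V \<subseteq> ?R\<^sup>+"
    by (rule irreducible_mat_iff_supp[OF A nn])
  have s: "irreducible_mat (A ^\<^sub>m 2) \<longleftrightarrow> ?V \<times> ?V \<subseteq> (?R O ?R)\<^sup>+"
    using irreducible_mat_iff_supp[OF pow_carrier_mat[OF A] nonnegative_mat_pow[OF A nn], of 2]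
    by (simp add: supp_mat_pow[OF A nn] relpow_square del: pow_mat.simps)
  have t: "irreducible_mat (transpose_mat A * A) \<longleftrightarrow> ?V \<times> ?V \<subseteq> (?R\<inverse> O ?R)\<^sup>+"
    using irreducible_mat_iff_supp[OF mult_carrier_mat[OF At(1) A]
        nonnegative_mat_mult[OF At(1) A At(2) nn]]
    by (simp add: supp_mat_mult[OF At(1) A At(2) nn] supp_mat_transpose)
  have u: "irreducible_mat (A * transpose_mat A) \<longleftrightarrow> ?V \<times> ?V \<subseteq> (?R O ?R\<inverse>)\<^sup>+"
    using irreducible_mat_iff_supp[OF mult_carrier_mat[OF A At(1)]
        nonnegative_mat_mult[OF A At(1) nn At(2)]]
    by (simp add: supp_mat_mult[OF A At(1) nn At(2)] supp_mat_transpose)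
  have s_a: "irreducible_mat (A ^\<^sub>m 2) \<Longrightarrow> irreducible_mat A"
    unfolding a s using trancl_relcomp_self_subset by blast
  have at_s: "irreducible_mat A \<Longrightarrow> irreducible_mat (transpose_mat A * A) \<Longrightarrow>
      irreducible_mat (A ^\<^sub>m 2)"
    unfolding a s t by (rule total_trancl_two_step[OF R])
  have t_u: "irreducible_mat A \<Longrightarrow>
      irreducible_mat (transpose_mat A * A) \<longleftrightarrow> irreducible_mat (A * transpose_mat A)"
    unfolding a t u by (rule total_trancl_comp_converse_iff[OF R])
  \<comment> \<open>Strong connectedness counts empty walks, so it holds even for the 1 by 1 zero
    matrix. The \<open>Domain\<close> condition, supplied by the bipartite graph, gives each vertex
    a first arc and so makes the walks nonempty.\<close>
  have "?V \<times> ?V \<subseteq> ?R\<^sup>+ \<longleftrightarrow> ?V \<times> ?V \<subseteq> ?R\<^sup>* \<and> ?V \<subseteq> Domain ?R"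
  proof
    assume conn: "?V \<times> ?V \<subseteq> ?R\<^sup>* \<and> ?V \<subseteq> Domain ?R"
    show "?V \<times> ?V \<subseteq> ?R\<^sup>+"
    proof (rule subrelI)
      fix i j assume ij: "(i, j) \<in> ?V \<times> ?V"
      with conn obtain k where k: "(i, k) \<in> ?R" by blast
      with R ij conn have "(k, j) \<in> ?R\<^sup>*" by blast
      with k show "(i, j) \<in> ?R\<^sup>+" by (rule rtrancl_into_trancl2)
    qed
  qed (use total_trancl_imp_Domain_Range(1) in \<open>blast intro: trancl_into_rtrancl\<close>)
  then have graphs: "irreducible_mat A \<and> irreducible_mat (transpose_mat A * A) \<longleftrightarrow>
      strongly_connected (with_proj (digraph_of_mat A)) \<and>
      Digraph_Component.connected (with_proj (bipartite_graph_of_mat A))"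
    unfolding a t strongly_connected_digraph_of_mat_iff[OF A assms(1)]
      connected_bipartite_graph_of_mat_iff[OF A assms(1)]
    by blast
  \<comment> \<open>Each of the first five items yields irreducibility of \<open>A\<close>, after
    which \<open>t_u\<close> exchanges the two products and \<open>at_s\<close> adds the
    square.\<close>
  from s_a at_s t_u graphs show ?thesis by argo
qed

end
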